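(* Let $F$ be a distribution on $\mathbb R$ and let $N\ge1$ be an integer. Let $c>0$ and $\Delta=(0,c]$. If $F\in\mathcal A_\Delta$ and $F^{*N}\in\mathcal S_\Delta\cap\mathcal D_\Delta$, then $F\in\mathcal S_\Delta$. Consequently, if $F\in\mathcal A_{loc}$ and $F^{*N}\in\mathcal S_{loc}\cap\mathcal D_{loc}$, then $F\in\mathcal S_{loc}$.
   Context: For $\Delta=(0,c]$ and a distribution $F$ on $\mathbb R$, $F(x+\Delta):=F((x,x+c])$. $F^{*n}$ is the $n$-fold convolution. $\alpha(x)\sim\beta(x)$ means $\alpha(x)/\beta(x)\to1$ as $x\to\infty$. A non-negative measurable function $\alpha$ belongs to $\mathcal L$ if there is $x_0>0$ with $\alpha(x)>0$ for $x\ge x_0$ and, for every fixed $y>0$, $\alpha(x+y)\sim\alpha(x)$. $F\in\mathcal L_\Delta$ if $x\mapsto F(x+\Delta)$ is in $\mathcal L$; $F\in\mathcal S_\Delta$ if $F\in\mathcal L_\Delta$ and $F^{*2}(x+\Delta)\sim 2F(x+\Delta)$. A function $\alpha:\mathbb R\to\mathbb R_+$ is almost decreasing if there exist $x_0>0$ and $K>0$ such that $\alpha(x+y)\le K\alpha(x)$ for all $x>x_0$, $y>0$. $F\in\mathcal D_\Delta$ if $x\mapsto F(x+\Delta)$ is almost decreasing. A function $\alpha:\mathbb R\to\mathbb R_+$ is asymptotic to a non-increasing function if for some $x_0>0$ it is locally bounded and positive on $[x_0,\infty)$, and $\sup_{t\ge x}\alpha(t)\sim\alpha(x)$ and $\inf_{x_0\le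 t\le x}\alpha(t)\sim\alpha(x)$. $F\in\mathcal A_\Delta$ if $x\mapsto F(x+\Delta)$ is asymptotic to a non-increasing function in this sense. $F\in\mathcal S_{loc}$ (resp. $\mathcal A_{loc}$, $\mathcal D_{loc}$) if $F\in\mathcal S_\Delta$ (resp. $\mathcal A_\Delta$, $\mathcal D_\Delta$) for all $\Delta=(0,c]$ with $c>0$. *)

theory Defs
  imports "HOL-Probability.Probability" "HOL-Library.Landau_Symbols"
begin

primrec conv_power :: "real measure \<Rightarrow> nat \<Rightarrow> real measure" where
  "conv_power F 0 = return borel 0"
| "conv_power F (Suc n) = (F \<star> conv_power F n)"

definition window :: "real \<Rightarrow> real measure \<Rightarrow> real \<Rightarrow> real" where
  "window c F x = measure F {x<..x + c}"

text \<open>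
  The library relation \<open>\<sim>[at_top]\<close> also relates functions at points where both vanish.
  It is only used below where the right-hand side is required to be eventually positive,
  so that it means exactly that the quotient tends to 1.
\<close>

definition long_tailed :: "(real \<Rightarrow> real) \<Rightarrow> bool" where
  "long_tailed \<alpha> \<longleftrightarrow>
     (\<forall>x. 0 \<le> \<alpha> x) \<and> \<alpha> \<in> borel_measurable borel \<and>
     (\<exists>x0>0. \<forall>x\<ge>x0. 0 < \<alpha> x) \<and>
     (\<forall>y>0. (\<lambda>x. \<alpha> (x + y)) \<sim>[at_top] \<alpha>)"

definition almost_decreasing :: "(real \<Rightarrow> real) \<Rightarrow> bool" where
  "almost_decreasing \<alpha> \<longleftrightarrow>
     (\<forall>x. 0 \<le> \<alpha> x) \<and>
     (\<exists>x0>0. \<exists>K>0. \<forall>x>x0. \<forall>y>0. \<alpha> (x + y) \<le> K * \<alpha> x)"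

text \<open>
  The condition \<open>bdd_above (\<alpha> ` {x0..})\<close> says that the suprema are finite, as the real-valued
  \<open>SUP\<close> is unspecified on unbounded sets. It adds nothing: \<open>sup\<^sub>t\<^sub>\<ge>\<^sub>x \<alpha>(t) \<sim> \<alpha>(x)\<close> forces the suprema
  to be finite for large \<open>x\<close>, and \<open>\<alpha>\<close> is bounded on compact subintervals of \<open>[x0, \<infinity>)\<close>.
\<close>

definition asymp_nonincreasing :: "(real \<Rightarrow> real) \<Rightarrow> bool" where
  "asymp_nonincreasing \<alpha> \<longleftrightarrow>
     (\<forall>x. 0 \<le> \<alpha> x) \<and>
     (\<exists>x0>0. (\<forall>b. bounded (\<alpha> ` {x0..b})) \<and> (\<forall>x\<ge>x0. 0 < \<alpha> x) \<and>
        bdd_above (\<alpha> ` {x0..}) \<and>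
        (\<lambda>x. SUP t\<in>{x..}. \<alpha> t) \<sim>[at_top] \<alpha> \<and>
        (\<lambda>x. INF t\<in>{x0..x}. \<alpha> t) \<sim>[at_top] \<alpha>)"

text \<open>In the following classes the real parameter \<open>c\<close> stands for \<open>\<Delta> = (0, c]\<close>.\<close>

definition L_Delta :: "real \<Rightarrow> real measure \<Rightarrow> bool" where
  "L_Delta c F \<longleftrightarrow> long_tailed (window c F)"

definition S_Delta :: "real \<Rightarrow> real measure \<Rightarrow> bool" where
  "S_Delta c F \<longleftrightarrow>
     L_Delta c F \<and> window c (conv_power F 2) \<sim>[at_top] (\<lambda>x. 2 * window c F x)"

definition D_Delta :: "real \<Rightarrow> real measure \<Rightarrow> bool" where
  "D_Delta c F \<longleftrightarrow> almost_decreasing (window c F)"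

definition A_Delta :: "real \<Rightarrow> real measure \<Rightarrow> bool" where
  "A_Delta c F \<longleftrightarrow> asymp_nonincreasing (window c F)"

definition S_loc :: "real measure \<Rightarrow> bool" where
  "S_loc F \<longleftrightarrow> (\<forall>c>0. S_Delta c F)"

definition D_loc :: "real measure \<Rightarrow> bool" where
  "D_loc F \<longleftrightarrow> (\<forall>c>0. D_Delta c F)"

definition A_loc :: "real measure \<Rightarrow> bool" where
  "A_loc F \<longleftrightarrow> (\<forall>c>0. A_Delta c F)"

end

theory Submission imports Defs begin

text \<open>
  Write \<open>f\<close> for the window function \<open>x \<mapsto> F(x + \<Delta>)\<close>, \<open>f\<^sub>k\<close> for that of the \<open>k\<close>-fold convolution and
  \<open>g = f\<^sub>N\<close>. The principle of a single big jump gives \<open>f\<^sub>k \<approx> k f\<close> up to a shift of the argument,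
  and for \<open>k = N\<close> the shift can be moved to \<open>g\<close>, which is long-tailed and so does not feel it.
  Hence \<open>N f \<sim> g\<close>, so \<open>f\<close> is long-tailed as well; then the shift is harmless for \<open>k = 2\<close> too,
  and \<open>f\<^sub>2 \<sim> 2 f\<close>.

  The shift is controlled by two non-increasing functions that are both equivalent to \<open>f\<close>:
  \<open>\<psi>(x) = inf\<^bsub>x0\<le>t\<le>x\<^esub> f(t) \<le> f(x)\<close> and \<open>\<phi>(x) = sup\<^bsub>t\<ge>x\<^esub> f(t) \<ge> f(x)\<close>.

  The lower bound \<open>f\<^sub>k(x) \<ge> k (1 - e) \<psi>(x + B)\<close> for large \<open>x\<close> rests on disjointness
  (\<open>conv_power_window_ge\<close>): one of the \<open>k\<close> summands is large while the others stay in a compact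
  interval, and these \<open>k\<close> events exclude each other. For \<open>k = N\<close> it yields \<open>N f \<le> (1 + e) g\<close> eventually,
  in particular \<open>f = O(g)\<close>.

  The upper bound \<open>f\<^sub>k(x) \<le> k \<phi>(x - B) + e g(x)\<close> (\<open>conv_power_window_le\<close>) is proved by induction on \<open>k\<close>.
  Split \<open>X + S\<^sub>k\<close> according to whether \<open>X \<le> A\<close>, \<open>S\<^sub>k \<le> A\<close>, or both exceed \<open>A\<close>. In the first two cases
  monotonicity of \<open>\<phi>\<close> and almost-monotonicity of \<open>g\<close> bound the integrand uniformly, including the
  contribution of large negative values. In the third case \<open>f\<close> and \<open>f\<^sub>k\<close> are both \<open>O(g)\<close>, so the
  probability is at most a constant times that of two independent variables with distribution \<open>F\<^sup>*\<^sup>N\<close>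
  both exceeding \<open>A - c\<close> with a sum in \<open>x + \<Delta>\<close> (\<open>joint_large_compare\<close>). As \<open>F\<^sup>*\<^sup>N\<close> belongs to \<open>S_Delta\<close>,
  choosing \<open>A\<close> large makes this an arbitrarily small multiple of \<open>g(x)\<close> for all large \<open>x\<close>
  (\<open>S_Delta_two_large\<close>).
\<close>

section \<open>Asymptotic equivalence as a pair of inequalities\<close>

lemma eventually_shift:
  fixes P :: "real \<Rightarrow> bool"
  assumes "eventually P at_top"
  shows "eventually (\<lambda>x. P (x + y)) at_top"
proof -
  obtain b where "\<And>x. x \<ge> b \<Longrightarrow> P x"
    using assms by (auto simp: eventually_at_top_linorder)
  then show ?thesis
    by (auto simp: eventually_at_top_linorder intro!: exI[of _ "b - y"])
qed

lemma filterlim_shift_at_top: "filterlim (\<lambda>x::real. x + y) at_top at_top"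
  by (auto simp: filterlim_iff intro: eventually_shift)

lemma asymp_equiv_imp_le:
  fixes f g :: "real \<Rightarrow> real"
  assumes "f \<sim>[at_top] g" and pos: "eventually (\<lambda>x. 0 < g x) at_top" and e: "e > 0"
  shows "eventually (\<lambda>x. f x \<le> (1 + e) * g x) at_top"
    and "eventually (\<lambda>x. (1 - e) * g x \<le> f x) at_top"
proof -
  have "((\<lambda>x. f x / g x) \<longlongrightarrow> 1) at_top"
    by (rule asymp_equivD_strong[OF assms(1)]) (use pos in \<open>auto elim: eventually_mono\<close>)
  then have "eventually (\<lambda>x. f x / g x < 1 + e) at_top" "eventually (\<lambda>x. 1 - e < f x / g x) at_top"
    using e by (auto intro: order_tendstoD)
  with pos show "eventually (\<lambda>x. f x \<le> (1 + e) * g x) at_top"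
    and "eventually (\<lambda>x. (1 - e) * g x \<le> f x) at_top"
    by (eventually_elim; simp add: field_simps)+
qed

lemma asymp_equiv_from_le:
  fixes f g :: "real \<Rightarrow> real"
  assumes pos: "eventually (\<lambda>x. 0 < g x) at_top"
    and le: "\<And>e. 0 < e \<Longrightarrow> e < 1 \<Longrightarrow> eventually (\<lambda>x. f x \<le> (1 + e) * g x) at_top"
    and ge: "\<And>e. 0 < e \<Longrightarrow> e < 1 \<Longrightarrow> eventually (\<lambda>x. (1 - e) * g x \<le> f x) at_top"
  shows "f \<sim>[at_top] g"
proof (rule asymp_equivI', rule tendstoI)
  fix d :: real assume "d > 0"
  define e where "e = min (d/2) (1/2)"
  have e: "0 < e" "e < 1" "e < d" using \<open>d > 0\<close> by (auto simp: e_def)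
  show "eventually (\<lambda>x. dist (f x / g x) 1 < d) at_top"
    using pos le[OF e(1,2)] ge[OF e(1,2)]
  proof eventually_elim
    case (elim x)
    then have "f x / g x \<le> 1 + e" "1 - e \<le> f x / g x" by (simp_all add: field_simps)
    then show ?case using e by (simp add: dist_real_def)
  qed
qed

lemma long_tailed_shift:
  assumes "long_tailed g"
  shows "(\<lambda>x. g (x + y)) \<sim>[at_top] g"
proof -
  consider "y > 0" | "y = 0" | "y < 0" by linarith
  then show ?thesis
  proof cases
    case 3
    then have "(\<lambda>x. g (x + (- y))) \<sim>[at_top] g"
      using assms unfolding long_tailed_def by (meson neg_0_less_iff_less)
    then have "(\<lambda>x. g (x + y + (- y))) \<sim>[at_top] (\<lambda>x. g (x + y))"
      by (rule asymp_equiv_compose'[OF _ filterlim_shift_at_top])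
    then show ?thesis by (simp add: asymp_equiv_sym)
  qed (use assms in \<open>auto simp: long_tailed_def\<close>)
qed

lemma long_tailed_pos:
  assumes "long_tailed g"
  shows "eventually (\<lambda>x. 0 < g x) at_top"
  using assms by (auto simp: long_tailed_def eventually_at_top_linorder)

section \<open>Sums of two independent variables restricted to rectangles\<close>

text \<open>
  The probability that \<open>U + V \<in> x + \<Delta>\<close>, \<open>U \<in> S\<close> and \<open>V \<in> T\<close> for independent \<open>U\<close> and \<open>V\<close> with
  distributions \<open>M\<close> and \<open>H\<close>.
\<close>

definition joint :: "real \<Rightarrow> real measure \<Rightarrow> real measure \<Rightarrow> real set \<Rightarrow> real set \<Rightarrow> real \<Rightarrow> real" where
  "joint c M H S T x =
     measure (M \<Otimes>\<^sub>M H) {p. fst p \<in> S \<and> snd p \<in> T \<and> x < fst p + snd p \<and> fst p + snd p \<le> x + c}"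

lemma joint_sets:
  assumes "real_distribution M" "real_distribution H" "S \<in> sets borel" "T \<in> sets borel"
  shows "{p. fst p \<in> S \<and> snd p \<in> T \<and> x < fst p + snd p \<and> fst p + snd p \<le> x + c} \<in> sets (M \<Otimes>\<^sub>M H)"
proof -
  interpret M: real_distribution M by fact
  interpret H: real_distribution H by fact
  have [measurable]: "S \<in> sets M" "T \<in> sets H" using assms by auto
  have "{p \<in> space (M \<Otimes>\<^sub>M H). fst p \<in> S \<and> snd p \<in> T \<and> x < fst p + snd p \<and> fst p + snd p \<le> x + c}
     \<in> sets (M \<Otimes>\<^sub>M H)" by measurable
  then show ?thesis by (simp add: space_pair_measure)
qed

lemma prob_space_pair:
  assumes "real_distribution M" "real_distribution H"
  shows "prob_space (M \<Otimes>\<^sub>M H)"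
proof -
  interpret M: real_distribution M by fact
  interpret H: real_distribution H by fact
  interpret P: pair_prob_space M H ..
  show ?thesis by (rule P.prob_space_axioms)
qed

lemma window_convolution:
  assumes "real_distribution M" "real_distribution H"
  shows "window c (M \<star> H) x = joint c M H UNIV UNIV x"
proof -
  interpret M: real_distribution M by fact
  interpret H: real_distribution H by fact
  have "window c (M \<star> H) x =
     measure (M \<Otimes>\<^sub>M H) ((\<lambda>(x, y). x + y) -` {x<..x+c} \<inter> space (M \<Otimes>\<^sub>M H))"
    unfolding window_def convolution_def by (rule measure_distr) auto
  also have "(\<lambda>(x, y). x + y) -` {x<..x+c} \<inter> space (M \<Otimes>\<^sub>M H) =
     {p. fst p \<in> UNIV \<and> snd p \<in> UNIV \<and> x < fst p + snd p \<and> fst p + snd p \<le> x + c}"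
    by (auto simp: space_pair_measure)
  finally show ?thesis by (simp add: joint_def)
qed

lemma window_measurable:
  assumes "real_distribution H"
  shows "window c H \<in> borel_measurable borel"
proof (cases "c \<ge> 0")
  case True
  interpret H: real_distribution H by fact
  have [measurable]: "cdf H \<in> borel_measurable borel"
    by (rule borel_measurable_mono) (auto intro: monoI H.cdf_nondecreasing)
  have "window c H = (\<lambda>x. cdf H (x + c) - cdf H x)"
  proof
    fix x
    show "window c H x = cdf H (x + c) - cdf H x"
    proof (cases "c = 0")
      case False
      then show ?thesis using True by (simp add: window_def H.cdf_diff_eq)
    qed (simp add: window_def)
  qed
  then show ?thesis by simp
next
  case False
  then have "window c H = (\<lambda>x. 0)" by (auto simp: window_def fun_eq_iff)
  then show ?thesis by simp
qed

lemma window_nonneg: "0 \<le> window c H x"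
  by (simp add: window_def)

lemma window_integrable:
  assumes "real_distribution M" "real_distribution H" "S \<in> sets borel"
  shows "integrable M (\<lambda>u. indicator S u * window c H (x - u))"
proof -
  interpret M: real_distribution M by fact
  interpret H: real_distribution H by fact
  note [measurable] = window_measurable[OF assms(2)] assms(3)
  have bound: "norm (indicator S u * window c H (x - u)) \<le> 1" for u
    by (auto simp: window_def indicator_def)
  show ?thesis
    by (rule M.integrable_const_bound[where B=1]) (use bound in \<open>auto intro!: AE_I2\<close>)
qed

text \<open>
  Conditioning on \<open>U = u\<close> turns the event into \<open>V \<in> x - u + \<Delta>\<close>. All estimates below are pointwise bounds
  on this integrand; the second summand is treated in the same way after \<open>joint_swap\<close>.
\<close>

lemma joint_eq_integral:
  assumes "real_distribution M" "real_distribution H" "S \<in> sets borel"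
  shows "joint c M H S UNIV x = (\<integral>u. indicator S u * window c H (x - u) \<partial>M)"
proof -
  interpret M: real_distribution M by fact
  interpret H: real_distribution H by fact
  let ?E = "{p. fst p \<in> S \<and> snd p \<in> UNIV \<and> x < fst p + snd p \<and> fst p + snd p \<le> x + c}"
  have E: "?E \<in> sets (M \<Otimes>\<^sub>M H)" by (rule joint_sets) (use assms in auto)
  have sec: "emeasure H (Pair u -` ?E) = ennreal (indicator S u * window c H (x - u))" for u
  proof (cases "u \<in> S")
    case True
    then have "Pair u -` ?E = {x-u<..x-u+c}" by auto
    then show ?thesis using True by (simp add: window_def H.emeasure_eq_measure)
  qed auto
  have "emeasure (M \<Otimes>\<^sub>M H) ?E = (\<integral>\<^sup>+u. ennreal (indicator S u * window c H (x - u)) \<partial>M)"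
    by (simp only: H.emeasure_pair_measure_alt[OF E] sec)
  also have "\<dots> = ennreal (\<integral>u. indicator S u * window c H (x - u) \<partial>M)"
    by (rule nn_integral_eq_integral) (use window_integrable[OF assms] in \<open>auto simp: window_nonneg\<close>)
  finally show ?thesis
    unfolding joint_def measure_def
    by (simp add: integral_nonneg_AE window_nonneg)
qed

lemma joint_swap:
  assumes "real_distribution M" "real_distribution H" "S \<in> sets borel" "T \<in> sets borel"
  shows "joint c M H S T x = joint c H M T S x"
proof -
  interpret M: real_distribution M by fact
  interpret H: real_distribution H by fact
  interpret pair_prob_space M H ..
  let ?E = "{p. fst p \<in> S \<and> snd p \<in> T \<and> x < fst p + snd p \<and> fst p + snd p \<le> x + c}"
  have E: "?E \<in> sets (M \<Otimes>\<^sub>M H)" by (rule joint_sets) fact+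
  have "joint c M H S T x = measure (distr (H \<Otimes>\<^sub>M M) (M \<Otimes>\<^sub>M H) (\<lambda>(x, y). (y, x))) ?E"
    unfolding joint_def using distr_pair_swap by simp
  also have "\<dots> = measure (H \<Otimes>\<^sub>M M) ((\<lambda>(x, y). (y, x)) -` ?E \<inter> space (H \<Otimes>\<^sub>M M))"
    by (rule measure_distr) (use E in auto)
  also have "(\<lambda>(x, y). (y, x)) -` ?E \<inter> space (H \<Otimes>\<^sub>M M) =
      {p. fst p \<in> T \<and> snd p \<in> S \<and> x < fst p + snd p \<and> fst p + snd p \<le> x + c}"
    by (auto simp: space_pair_measure add.commute)
  finally show ?thesis by (simp add: joint_def)
qed

lemma joint_mono:
  assumes "real_distribution M" "real_distribution H" "S' \<in> sets borel" "T' \<in> sets borel"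
    and "\<And>u v. u \<in> S \<Longrightarrow> v \<in> T \<Longrightarrow> x < u + v \<Longrightarrow> u + v \<le> x + c \<Longrightarrow> u \<in> S' \<and> v \<in> T'"
  shows "joint c M H S T x \<le> joint c M H S' T' x"
proof -
  interpret prob_space "M \<Otimes>\<^sub>M H" by (rule prob_space_pair) fact+
  show ?thesis unfolding joint_def
    by (rule finite_measure_mono) (use assms joint_sets[OF assms(1-4)] in auto)
qed

text \<open>
  If \<open>U \<in> S\<close> and \<open>V \<in> T\<close> exclude \<open>U + V > x\<close>, then at most one of \<open>U \<in> S\<close>, \<open>V \<in> T\<close> happens on the event.
  With \<open>S\<close> and \<open>T\<close> bounded above, the first two terms are the ones with one big jump.
\<close>

lemma joint_split:
  assumes "real_distribution M" "real_distribution H" "S \<in> sets borel" "T \<in> sets borel"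
    and disj: "\<And>u v. u \<in> S \<Longrightarrow> v \<in> T \<Longrightarrow> u + v \<le> x"
  shows "joint c M H UNIV UNIV x =
    joint c M H S UNIV x + joint c M H UNIV T x + joint c M H (- S) (- T) x"
proof -
  interpret prob_space "M \<Otimes>\<^sub>M H" by (rule prob_space_pair) fact+
  define E where
    "E S T = {p. fst p \<in> S \<and> snd p \<in> T \<and> x < fst p + snd p \<and> fst p + snd p \<le> x + c}" for S T
  have sets: "E S UNIV \<in> events" "E UNIV T \<in> events" "E (- S) (- T) \<in> events"
    unfolding E_def by (rule joint_sets; use assms in simp)+
  have "E UNIV UNIV = (E S UNIV \<union> E UNIV T) \<union> E (- S) (- T)"
    unfolding E_def by auto
  then have "prob (E UNIV UNIV) = prob ((E S UNIV \<union> E UNIV T) \<union> E (- S) (- T))" by simp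
  also have "\<dots> = prob (E S UNIV \<union> E UNIV T) + prob (E (- S) (- T))"
    by (rule finite_measure_Union) (use sets in \<open>auto simp: E_def\<close>)
  also have "prob (E S UNIV \<union> E UNIV T) = prob (E S UNIV) + prob (E UNIV T)"
    by (rule finite_measure_Union) (use sets disj in \<open>force simp: E_def\<close>)+
  finally show ?thesis by (simp add: joint_def E_def)
qed

lemma joint_nonneg: "0 \<le> joint c M H S T x"
  by (simp add: joint_def)

lemma joint_compare:
  assumes "real_distribution M" "real_distribution H" "real_distribution G" "S \<in> sets borel"
    and "\<And>u. u \<in> S \<Longrightarrow> window c H (x - u) \<le> D * window c G (x - u)"
  shows "joint c M H S UNIV x \<le> D * joint c M G S UNIV x"
proof -
  have "(\<integral>u. indicator S u * window c H (x - u) \<partial>M)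
      \<le> (\<integral>u. D * (indicator S u * window c G (x - u)) \<partial>M)"
    by (intro integral_mono integrable_mult_right window_integrable assms)
      (auto simp: indicator_def assms(5))
  then show ?thesis
    using assms by (simp add: joint_eq_integral)
qed

lemma joint_le_const:
  assumes "real_distribution M" "real_distribution H" "S \<in> sets borel"
    and "0 \<le> w" and "\<And>u. u \<in> S \<Longrightarrow> window c H (x - u) \<le> w"
  shows "joint c M H S UNIV x \<le> w"
proof -
  interpret M: real_distribution M by fact
  have "(\<integral>u. indicator S u * window c H (x - u) \<partial>M) \<le> (\<integral>u. w \<partial>M)"
    by (intro integral_mono window_integrable assms)
      (auto simp: indicator_def assms(4,5))
  then show ?thesis
    using assms M.prob_space by (simp add: joint_eq_integral)
qed

lemma joint_ge_const:
  assumes "real_distribution M" "real_distribution H" "S \<in> sets borel"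
    and "\<And>u. u \<in> S \<Longrightarrow> w \<le> window c H (x - u)"
  shows "w * measure M S \<le> joint c M H S UNIV x"
proof -
  interpret M: real_distribution M by fact
  have [simp]: "S \<in> sets M" using assms by simp
  have "(\<integral>u. w * indicator S u \<partial>M) \<le> (\<integral>u. indicator S u * window c H (x - u) \<partial>M)"
    by (intro integral_mono integrable_mult_right integrable_real_indicator window_integrable assms)
      (auto simp: indicator_def assms(3,4) M.emeasure_eq_measure)
  then show ?thesis
    using assms by (simp add: joint_eq_integral)
qed

section \<open>Convolution powers as distributions\<close>

lemma real_distribution_convolution:
  assumes "real_distribution M" "real_distribution H"
  shows "real_distribution (M \<star> H)"
proof -
  interpret M: real_distribution M by fact
  interpret H: real_distribution H by fact
  interpret P: prob_space "M \<Otimes>\<^sub>M H" by (rule prob_space_pair) fact+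
  have "prob_space (M \<star> H)" unfolding convolution_def
    by (rule P.prob_space_distr) auto
  then show ?thesis by (simp add: real_distribution_def real_distribution_axioms_def)
qed

lemma real_distribution_return: "real_distribution (return borel (a::real))"
  by (simp add: real_distribution_def real_distribution_axioms_def prob_space_return)

lemma real_distribution_conv_power:
  assumes "real_distribution F"
  shows "real_distribution (conv_power F k)"
  by (induction k) (auto intro: real_distribution_convolution real_distribution_return assms)

lemma convolution_return:
  assumes "real_distribution M"
  shows "M \<star> return borel 0 = M"
proof (rule measure_eqI)
  interpret M: real_distribution M by fact
  interpret R: real_distribution "return borel (0::real)" by (rule real_distribution_return)
  fix A assume "A \<in> sets (M \<star> return borel 0)"
  then have [measurable]: "A \<in> sets borel" by simp
  have "emeasure (M \<star> return borel 0) A = (\<integral>\<^sup>+x. \<integral>\<^sup>+y. indicator A (x + y) \<partial>return borel 0 \<partial>M)"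
    by (rule convolution_emeasure') (auto intro: M.finite_measure_axioms R.finite_measure_axioms)
  also have "\<dots> = (\<integral>\<^sup>+x. indicator A x \<partial>M)"
    by (intro nn_integral_cong) (simp add: nn_integral_return)
  also have "\<dots> = emeasure M A" by simp
  finally show "emeasure (M \<star> return borel 0) A = emeasure M A" .
qed (use assms in \<open>simp add: real_distribution.events_eq_borel\<close>)

lemma conv_power_2:
  assumes "real_distribution M"
  shows "conv_power M 2 = (M \<star> M)"
  by (simp add: numeral_2_eq_2 convolution_return[OF assms])

lemma eventually_interval_mass:
  assumes "real_distribution M" "e > 0"
  shows "eventually (\<lambda>A. 1 - e < measure M {-A..A}) at_top"
proof -
  interpret M: real_distribution M by fact
  have "((\<lambda>A. cdf M A - cdf M (- A)) \<longlongrightarrow> 1 - 0) at_top"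
    by (intro tendsto_diff M.cdf_lim_at_top_prob
        filterlim_compose[OF M.cdf_lim_at_bot filterlim_uminus_at_bot_at_top])
  then have "eventually (\<lambda>A. 1 - e < cdf M A - cdf M (- A)) at_top"
    using assms(2) by (auto intro: order_tendstoD)
  with eventually_gt_at_top[of 0] show ?thesis
  proof eventually_elim
    case (elim A)
    have "cdf M A - cdf M (- A) = measure M {-A<..A}"
      using elim by (intro M.cdf_diff_eq) auto
    also have "\<dots> \<le> measure M {-A..A}" by (rule M.finite_measure_mono) auto
    finally show ?case using elim by linarith
  qed
qed

section \<open>Lower bounds\<close>

text \<open>
  By induction on \<open>k\<close>: either the new summand lies in \<open>[-A, A]\<close> and the sum of the others accounts for
  \<open>x\<close>, which contributes \<open>k\<close> copies of \<open>\<psi>\<close>, or the other way round, which contributes one more.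
  Each step costs a shift by \<open>A\<close>, and the mass outside \<open>[-A, A]\<close>.
\<close>

lemma conv_power_window_ge:
  assumes F: "real_distribution F"
    and mono: "\<And>s t. x0 \<le> s \<Longrightarrow> s \<le> t \<Longrightarrow> \<psi> t \<le> \<psi> s"
    and nonneg: "\<And>t. x0 \<le> t \<Longrightarrow> 0 \<le> \<psi> t"
    and le: "\<And>t. x0 \<le> t \<Longrightarrow> \<psi> t \<le> window c F t"
    and e: "0 < e" "e < 1"
  shows "\<exists>B\<ge>0. eventually (\<lambda>x. real k * (1 - e) * \<psi> (x + B) \<le> window c (conv_power F k) x) at_top"
  using e
proof (induction k arbitrary: e)
  case 0
  show ?case by (auto intro!: exI[of _ 0] simp: window_nonneg)
next
  case (Suc k)
  let ?H = "conv_power F k"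
  have H: "real_distribution ?H" by (rule real_distribution_conv_power[OF F])
  define d where "d = e / 2"
  have d: "0 < d" "d < 1" using Suc.prems by (auto simp: d_def)
  have sq: "1 - e \<le> (1 - d) * (1 - d)" "1 - e \<le> 1 - d"
    using Suc.prems by (auto simp: d_def field_simps)
  obtain B where B: "B \<ge> 0" "eventually (\<lambda>x. real k * (1 - d) * \<psi> (x + B) \<le> window c ?H x) at_top"
    using Suc.IH[OF d] by auto
  then obtain x1 where x1: "\<And>x. x \<ge> x1 \<Longrightarrow> real k * (1 - d) * \<psi> (x + B) \<le> window c ?H x"
    by (auto simp: eventually_at_top_linorder)
  have "eventually (\<lambda>A. 1 - d < measure F {-A..A} \<and> 1 - d < measure ?H {-A..A} \<and> 0 \<le> A) at_top"
    by (intro eventually_conj eventually_interval_mass F H d eventually_ge_at_top)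
  then obtain A where A: "1 - d < measure F {-A..A}" "1 - d < measure ?H {-A..A}" "0 \<le> A"
    by (auto dest: eventually_happens)
  let ?I = "{-A..A}"
  have "real (Suc k) * (1 - e) * \<psi> (x + (A + B)) \<le> window c (conv_power F (Suc k)) x"
    if x: "x \<ge> max (max x0 x1 + A) (2 * A)" for x
  proof -
    have p0: "0 \<le> \<psi> (x + (A + B))" using x A B by (intro nonneg) auto
    have "real k * (1 - d) * \<psi> (x + (A + B)) * (1 - d) \<le>
        real k * (1 - d) * \<psi> (x + (A + B)) * measure F ?I"
      using A d p0 by (intro mult_left_mono mult_nonneg_nonneg) auto
    also have "\<dots> \<le> joint c F ?H ?I UNIV x"
    proof (rule joint_ge_const[OF F H])
      fix u assume u: "u \<in> ?I"
      have "\<psi> (x + (A + B)) \<le> \<psi> (x - u + B)"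
        using u x A B by (intro mono) auto
      then have "real k * (1 - d) * \<psi> (x + (A + B)) \<le> real k * (1 - d) * \<psi> (x - u + B)"
        using d by (intro mult_left_mono) auto
      also have "\<dots> \<le> window c ?H (x - u)" using u x by (intro x1) auto
      finally show "real k * (1 - d) * \<psi> (x + (A + B)) \<le> window c ?H (x - u)" .
    qed auto
    finally have 1: "real k * (1 - d) * \<psi> (x + (A + B)) * (1 - d) \<le> joint c F ?H ?I UNIV x" .
    have "\<psi> (x + (A + B)) * (1 - d) \<le> \<psi> (x + (A + B)) * measure ?H ?I"
      using A p0 by (intro mult_left_mono) auto
    also have "\<dots> \<le> joint c ?H F ?I UNIV x"
    proof (rule joint_ge_const[OF H F])
      fix u assume u: "u \<in> ?I"
      have "\<psi> (x + (A + B)) \<le> \<psi> (x - u)"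
        using u x A B by (intro mono) auto
      also have "\<dots> \<le> window c F (x - u)" using u x by (intro le) auto
      finally show "\<psi> (x + (A + B)) \<le> window c F (x - u)" .
    qed auto
    also have "\<dots> = joint c F ?H UNIV ?I x" by (rule joint_swap[OF H F]) auto
    finally have 2: "\<psi> (x + (A + B)) * (1 - d) \<le> joint c F ?H UNIV ?I x" .
    have "window c (conv_power F (Suc k)) x = joint c F ?H UNIV UNIV x"
      by (simp add: window_convolution[OF F H])
    also have "\<dots> = joint c F ?H ?I UNIV x + joint c F ?H UNIV ?I x + joint c F ?H (- ?I) (- ?I) x"
      by (rule joint_split[OF F H]) (use x in auto)
    finally have 3: "joint c F ?H ?I UNIV x + joint c F ?H UNIV ?I x
        \<le> window c (conv_power F (Suc k)) x"
      using joint_nonneg[of c F ?H "- ?I" "- ?I" x] by linarith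
    have "real (Suc k) * (1 - e) * \<psi> (x + (A + B)) =
        (real k * \<psi> (x + (A + B))) * (1 - e) + \<psi> (x + (A + B)) * (1 - e)"
      by (simp add: algebra_simps)
    also have "\<dots> \<le> (real k * \<psi> (x + (A + B))) * ((1 - d) * (1 - d)) + \<psi> (x + (A + B)) * (1 - d)"
      using p0 sq by (intro add_mono mult_left_mono) auto
    also have "\<dots> \<le> window c (conv_power F (Suc k)) x"
      using 1 2 3 by (simp add: algebra_simps)
    finally show ?thesis .
  qed
  then have "eventually (\<lambda>x. real (Suc k) * (1 - e) * \<psi> (x + (A + B))
      \<le> window c (conv_power F (Suc k)) x) at_top"
    unfolding eventually_at_top_linorder by blast
  then show ?case using A B by (intro exI[of _ "A + B"]) auto
qed

section \<open>Two large summands\<close>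

text \<open>
  For fixed \<open>u\<close> the ratio of \<open>window c H (x - u)\<close> and \<open>window c H x\<close> tends to 1. Cutting it off at 1
  loses nothing in the limit and provides the dominating constant, which the ratio itself may lack.
\<close>

lemma long_tailed_joint_ge:
  assumes M: "real_distribution M" and H: "real_distribution H"
    and lt: "long_tailed (window c H)" and S: "S \<in> sets borel" and e: "1 - e < measure M S"
  shows "eventually (\<lambda>x. (1 - e) * window c H x \<le> joint c M H S UNIV x) at_top"
proof -
  interpret M: real_distribution M by fact
  note [measurable] = window_measurable[OF H] S
  let ?s = "\<lambda>x u. indicator S u * min 1 (window c H (x - u) / window c H x)"
  have pw: "((\<lambda>x. ?s x u) \<longlongrightarrow> indicator S u) at_top" for u
  proof -
    have "((\<lambda>x. window c H (x + (- u)) / window c H x) \<longlongrightarrow> 1) at_top"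
      by (rule asymp_equivD_strong[OF long_tailed_shift[OF lt]])
        (use long_tailed_pos[OF lt] in \<open>auto elim: eventually_mono\<close>)
    then have "((\<lambda>x. ?s x u) \<longlongrightarrow> indicator S u * min 1 1) at_top"
      by (intro tendsto_intros) simp
    then show ?thesis by simp
  qed
  have "((\<lambda>x. integral\<^sup>L M (?s x)) \<longlongrightarrow> integral\<^sup>L M (indicator S)) at_top"
  proof (rule integral_dominated_convergence_at_top[where w="\<lambda>_. 1"])
    show "eventually (\<lambda>x. AE u in M. norm (?s x u) \<le> 1) at_top"
      by (auto simp: indicator_def window_nonneg)
  qed (use pw in auto)
  then have "eventually (\<lambda>x. 1 - e < integral\<^sup>L M (?s x)) at_top"
    using e by (auto intro: order_tendstoD)
  with long_tailed_pos[OF lt] show ?thesis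
  proof eventually_elim
    case (elim x)
    have "(1 - e) * window c H x \<le> window c H x * integral\<^sup>L M (?s x)"
      using elim by (simp add: mult.commute)
    also have "\<dots> = (\<integral>u. window c H x * ?s x u \<partial>M)" by simp
    also have "\<dots> \<le> (\<integral>u. indicator S u * window c H (x - u) \<partial>M)"
    proof (rule integral_mono)
      show "integrable M (\<lambda>u. window c H x * ?s x u)"
        by (intro integrable_mult_right M.integrable_const_bound[where B=1])
          (auto simp: indicator_def window_nonneg)
      show "window c H x * ?s x u \<le> indicator S u * window c H (x - u)" for u
        using elim by (auto simp: indicator_def min_def field_simps)
    qed (rule window_integrable[OF M H S])
    also have "\<dots> = joint c M H S UNIV x" by (simp add: joint_eq_integral[OF M H S])
    finally show ?case .
  qed
qed

text \<open>
  The two cases in which one variable is at most \<open>A\<close> already contribute almost \<open>2 G(x + \<Delta>)\<close> when \<open>A\<close> is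
  large. This is all of \<open>G\<^sup>*\<^sup>2(x + \<Delta>)\<close> asymptotically, so next to nothing is left for two large variables.
\<close>

lemma S_Delta_two_large:
  assumes G: "real_distribution G" and S: "S_Delta c G" and e: "e > 0"
  shows "eventually (\<lambda>A. eventually (\<lambda>x. joint c G G {A<..} {A<..} x \<le> e * window c G x) at_top) at_top"
  using eventually_interval_mass[OF G, of "e/3", simplified, OF e]
proof eventually_elim
  case (elim A)
  interpret G: real_distribution G by fact
  have lt: "long_tailed (window c G)" using S by (simp add: S_Delta_def L_Delta_def)
  have "measure G {-A..A} \<le> measure G {..A}" by (rule G.finite_measure_mono) auto
  then have "1 - e/3 < measure G {..A}" using elim by linarith
  then have one: "eventually (\<lambda>x. (1 - e/3) * window c G x \<le> joint c G G {..A} UNIV x) at_top"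
    by (intro long_tailed_joint_ge[OF G G lt]) auto
  have "eventually (\<lambda>x. window c (conv_power G 2) x \<le> (1 + e/6) * (2 * window c G x)) at_top"
    by (rule asymp_equiv_imp_le)
      (use S e long_tailed_pos[OF lt] in \<open>auto simp: S_Delta_def\<close>)
  with one eventually_ge_at_top[of "2 * A"] show ?case
  proof eventually_elim
    case (elim x)
    have "joint c G G UNIV UNIV x = joint c G G {..A} UNIV x + joint c G G UNIV {..A} x
        + joint c G G (- {..A}) (- {..A}) x"
      by (rule joint_split[OF G G]) (use elim in auto)
    moreover have "joint c G G UNIV {..A} x = joint c G G {..A} UNIV x"
      by (rule joint_swap[OF G G]) auto
    moreover have "- {..A} = {A<..}" by auto
    moreover have "window c (conv_power G 2) x = joint c G G UNIV UNIV x"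
      by (simp add: conv_power_2[OF G] window_convolution[OF G G])
    ultimately show ?case using elim by (simp add: algebra_simps)
  qed
qed

text \<open>
  The two distributions are replaced by \<open>G\<close> one at a time, each time while the other variable is
  the one conditioned on. A comparison of windows allows no restriction on the variable being
  replaced, so its bound \<open>v > A\<close> is first rewritten as the upper bound \<open>u < x + c - A\<close> on the other.
  As the sum is only known up to \<open>c\<close>, rewriting it back gives \<open>v > A - c\<close> only.
\<close>

lemma joint_large_compare:
  assumes M: "real_distribution M" and H: "real_distribution H" and G: "real_distribution G"
    and MG: "\<And>t. x1 \<le> t \<Longrightarrow> window c M t \<le> C * window c G t"
    and HG: "\<And>t. x1 \<le> t \<Longrightarrow> window c H t \<le> D * window c G t"
    and "0 \<le> C" "0 \<le> D" "0 \<le> c" "x1 + c \<le> A"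
  shows "joint c M H {A<..} {A<..} x \<le> C * D * joint c G G {A - c<..} {A - c<..} x"
proof -
  let ?R = "{A<..<x + c - A}" and ?R' = "{A - c<..<x + c - A}"
  have "joint c M H {A<..} {A<..} x \<le> joint c M H ?R UNIV x"
    by (rule joint_mono[OF M H]) auto
  also have "\<dots> \<le> D * joint c M G ?R UNIV x"
    by (rule joint_compare[OF M H G]) (use assms in auto)
  also have "\<dots> \<le> D * (C * joint c G G {A - c<..} {A - c<..} x)"
  proof (rule mult_left_mono[OF _ \<open>0 \<le> D\<close>])
    have "joint c M G ?R UNIV x \<le> joint c M G UNIV ?R' x"
      by (rule joint_mono[OF M G]) auto
    also have "joint c M G UNIV ?R' x = joint c G M ?R' UNIV x"
      by (rule joint_swap[OF M G]) auto
    also have "\<dots> \<le> C * joint c G G ?R' UNIV x"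
      by (rule joint_compare[OF G M G]) (use assms in auto)
    also have "\<dots> \<le> C * joint c G G {A - c<..} {A - c<..} x"
      by (rule mult_left_mono[OF joint_mono[OF G G] \<open>0 \<le> C\<close>]) (use \<open>0 \<le> c\<close> in auto)
    finally show "joint c M G ?R UNIV x \<le> C * joint c G G {A - c<..} {A - c<..} x" .
  qed
  finally show ?thesis by (simp add: mult_ac)
qed

section \<open>Upper bounds\<close>

text \<open>
  The error term \<open>e g(x)\<close> in the induction hypothesis is convolved with \<open>F\<close> in the next step. It stays
  of order \<open>g(x)\<close> because \<open>g\<close> is almost decreasing, with a constant \<open>K\<close> that is known beforehand:
  the hypothesis is therefore used with \<open>e / (4 K)\<close> in place of \<open>e\<close>.
\<close>

lemma conv_power_window_le:
  assumes F: "real_distribution F" and G: "real_distribution G" and "0 \<le> c"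
    and S: "S_Delta c G" and D: "D_Delta c G"
    and mono: "\<And>s t. x0 \<le> s \<Longrightarrow> s \<le> t \<Longrightarrow> \<phi> t \<le> \<phi> s"
    and le: "\<And>t. x0 \<le> t \<Longrightarrow> window c F t \<le> \<phi> t"
    and "0 \<le> C" and bound: "eventually (\<lambda>x. \<phi> x \<le> C * window c G x) at_top"
    and e: "0 < e"
  shows "\<exists>B\<ge>0. eventually (\<lambda>x. window c (conv_power F k) x \<le> real k * \<phi> (x - B) + e * window c G x) at_top"
  using e
proof (induction k arbitrary: e)
  case 0
  have "window c (conv_power F 0) x = 0" if "x \<ge> 0" for x
    using that by (simp add: window_def measure_return)
  then show ?case using 0
    by (auto intro!: exI[of _ 0] exI[of _ "0::real"] simp: eventually_at_top_linorder window_nonneg)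
next
  case (Suc k)
  let ?H = "conv_power F k" and ?g = "window c G"
  have H: "real_distribution ?H" by (rule real_distribution_conv_power[OF F])
  have lt: "long_tailed ?g" using S by (simp add: S_Delta_def L_Delta_def)
  have shift: "eventually (\<lambda>x. ?g (x + y) \<le> 2 * ?g x) at_top" for y
    using asymp_equiv_imp_le(1)[OF long_tailed_shift[OF lt] long_tailed_pos[OF lt], of 1] by simp
  have \<phi>0: "0 \<le> \<phi> t" if "x0 \<le> t" for t
    using le[OF that] window_nonneg[of c F t] by linarith
  \<comment> \<open>Raising the constant to at least 1 includes the increment 0.\<close>
  obtain xK K where K: "K > 0" "\<And>x y. x > xK \<Longrightarrow> y > 0 \<Longrightarrow> ?g (x + y) \<le> K * ?g x"
    using D unfolding D_Delta_def almost_decreasing_def by blast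
  define K' where "K' = max K 1"
  have K': "?g (x + y) \<le> K' * ?g x" if "x > xK" "y \<ge> 0" for x y
  proof (cases "y = 0")
    case True
    have "1 * ?g x \<le> K' * ?g x"
      by (intro mult_right_mono) (auto simp: window_nonneg K'_def)
    then show ?thesis using True by simp
  next
    case False
    then have "?g (x + y) \<le> K * ?g x" using K that by auto
    also have "\<dots> \<le> K' * ?g x"
      by (intro mult_right_mono) (auto simp: window_nonneg K'_def)
    finally show ?thesis .
  qed
  have K'0: "K' > 0" by (simp add: K'_def)

  \<comment> \<open>One factor 2 absorbs the shift of \<open>g\<close> by \<open>A\<close>, the other leaves half of \<open>e\<close> for two large summands.\<close>
  define d where "d = e / (4 * K')"
  have d: "d > 0" using Suc.prems K'0 by (simp add: d_def)
  obtain B where B: "B \<ge> 0"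
    and evB: "eventually (\<lambda>x. window c ?H x \<le> real k * \<phi> (x - B) + d * ?g x) at_top"
    using Suc.IH[OF d] by auto
  \<comment> \<open>The induction hypothesis also shows that the window of the convolution power is \<open>O(g)\<close>.\<close>
  define E where "E = real k * C * 2 + d"
  have E0: "E \<ge> 0" using d \<open>0 \<le> C\<close> by (simp add: E_def)
  have evE: "eventually (\<lambda>x. window c ?H x \<le> E * ?g x) at_top"
    using evB eventually_shift[OF bound, of "- B"] shift[of "- B"]
  proof eventually_elim
    case (elim x)
    have "\<phi> (x - B) \<le> C * (2 * ?g x)"
      using elim(2) mult_left_mono[OF elim(3) \<open>0 \<le> C\<close>] by simp
    then have "real k * \<phi> (x - B) \<le> real k * (C * (2 * ?g x))" by (intro mult_left_mono) auto
    then show ?case using elim(1) by (simp add: E_def algebra_simps)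
  qed
  have evF: "eventually (\<lambda>x. window c F x \<le> C * ?g x) at_top"
    using bound eventually_ge_at_top[of x0] by eventually_elim (use le in force)
  obtain x1 where x1: "\<And>x. x \<ge> x1 \<Longrightarrow> window c ?H x \<le> real k * \<phi> (x - B) + d * ?g x"
     "\<And>x. x \<ge> x1 \<Longrightarrow> window c ?H x \<le> E * ?g x" "\<And>x. x \<ge> x1 \<Longrightarrow> window c F x \<le> C * ?g x"
    using eventually_conj[OF evB eventually_conj[OF evE evF]]
    by (auto simp: eventually_at_top_linorder)
  define \<eta> where "\<eta> = e / (2 * (C * E + 1))"
  have CE: "C * E \<ge> 0" using E0 \<open>0 \<le> C\<close> by simp
  then have \<eta>: "\<eta> > 0" using Suc.prems by (simp add: \<eta>_def)
  have "eventually (\<lambda>A. eventually (\<lambda>x. joint c G G {A - c<..} {A - c<..} x \<le> \<eta> * ?g x) at_top) at_top"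
    using eventually_shift[OF S_Delta_two_large[OF G S \<eta>], of "- c"] by simp
  then have "eventually (\<lambda>A. eventually (\<lambda>x. joint c G G {A - c<..} {A - c<..} x \<le> \<eta> * ?g x) at_top
      \<and> x1 + c \<le> A \<and> 0 \<le> A) at_top"
    by (intro eventually_conj eventually_ge_at_top)
  then obtain A where A: "x1 + c \<le> A" "0 \<le> A"
    "eventually (\<lambda>x. joint c G G {A - c<..} {A - c<..} x \<le> \<eta> * ?g x) at_top"
    by (auto dest: eventually_happens)
  have "eventually (\<lambda>x. window c (conv_power F (Suc k)) x
      \<le> real (Suc k) * \<phi> (x - (A + B)) + e * ?g x) at_top"
    using A(3) shift[of "- A"] eventually_ge_at_top[of "max (max x0 x1 + A + B) (2 * A)"]
      eventually_gt_at_top[of "xK + A"]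
  proof eventually_elim
    case (elim x)
    let ?w = "real k * \<phi> (x - (A + B)) + d * K' * (2 * ?g x)"
    have p0: "0 \<le> \<phi> (x - (A + B))" using elim by (intro \<phi>0) auto
    have 1: "joint c F ?H {..A} UNIV x \<le> ?w"
    proof (rule joint_le_const[OF F H])
      show "0 \<le> ?w" using p0 d K'0 by (simp add: window_nonneg)
      fix u assume u: "u \<in> {..A}"
      have "window c ?H (x - u) \<le> real k * \<phi> (x - u - B) + d * ?g (x - u)"
        using u elim B by (intro x1) auto
      moreover have "real k * \<phi> (x - u - B) \<le> real k * \<phi> (x - (A + B))"
        using u elim by (intro mult_left_mono mono) auto
      moreover have "d * ?g (x - u) \<le> d * (K' * (2 * ?g x))"
      proof (rule mult_left_mono)
        have "?g (x - u) = ?g ((x - A) + (A - u))" by simp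
        also have "\<dots> \<le> K' * ?g (x - A)" by (rule K') (use u elim in auto)
        also have "\<dots> \<le> K' * (2 * ?g x)" using elim K'0 by (intro mult_left_mono) auto
        finally show "?g (x - u) \<le> K' * (2 * ?g x)" .
      qed (use d in simp)
      ultimately show "window c ?H (x - u) \<le> ?w" by (simp add: mult_ac)
    qed auto
    have "joint c F ?H UNIV {..A} x = joint c ?H F {..A} UNIV x"
      by (rule joint_swap[OF F H]) auto
    also have "\<dots> \<le> \<phi> (x - (A + B))"
    proof (rule joint_le_const[OF H F])
      fix u assume u: "u \<in> {..A}"
      have "window c F (x - u) \<le> \<phi> (x - u)" using u elim B by (intro le) auto
      also have "\<dots> \<le> \<phi> (x - (A + B))" using u elim B by (intro mono) auto
      finally show "window c F (x - u) \<le> \<phi> (x - (A + B))" .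
    qed (use p0 in auto)
    finally have 2: "joint c F ?H UNIV {..A} x \<le> \<phi> (x - (A + B))" .
    have "joint c F ?H {A<..} {A<..} x \<le> C * E * joint c G G {A - c<..} {A - c<..} x"
      by (rule joint_large_compare[OF F H G x1(3,2)]) (use A E0 \<open>0 \<le> C\<close> \<open>0 \<le> c\<close> in auto)
    also have "\<dots> \<le> C * E * (\<eta> * ?g x)" using elim CE by (intro mult_left_mono) auto
    also have "\<dots> = (C * E * \<eta>) * ?g x" by simp
    also have "\<dots> \<le> (e / 2) * ?g x"
    proof (rule mult_right_mono)
      show "C * E * \<eta> \<le> e / 2"
        using CE Suc.prems by (simp add: \<eta>_def field_simps)
    qed (rule window_nonneg)
    finally have 3: "joint c F ?H {A<..} {A<..} x \<le> (e / 2) * ?g x" .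
    have "window c (conv_power F (Suc k)) x = joint c F ?H UNIV UNIV x"
      by (simp add: window_convolution[OF F H])
    also have "\<dots> = joint c F ?H {..A} UNIV x + joint c F ?H UNIV {..A} x
        + joint c F ?H (- {..A}) (- {..A}) x"
      by (rule joint_split[OF F H]) (use elim in auto)
    also have "- {..A} = {A<..}" by auto
    finally have 4: "window c (conv_power F (Suc k)) x
      \<le> ?w + \<phi> (x - (A + B)) + (e / 2) * ?g x" using 1 2 3 by linarith
    have "d * K' * (2 * ?g x) = (e / 2) * ?g x"
      using K'0 by (simp add: d_def)
    with 4 have "window c (conv_power F (Suc k)) x
      \<le> real k * \<phi> (x - (A + B)) + \<phi> (x - (A + B)) + e * ?g x" by linarith
    then show ?case by (simp add: algebra_simps)
  qed
  then show ?case using A B by (intro exI[of _ "A + B"]) auto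
qed

section \<open>Convolution roots\<close>

text \<open>
  The bounds for \<open>k = N\<close> are read at \<open>x - B\<close> and \<open>x + B\<close>, so that the shift falls on the long-tailed \<open>g\<close>
  and the monotone functions, evaluated at \<open>x\<close>, can be replaced by \<open>f\<close>. For \<open>k = 2\<close> the shift falls on
  \<open>f\<close>, whose long-tailedness is then known.
\<close>

lemma S_Delta_convolution_root:
  assumes F: "real_distribution F" and N: "N \<ge> 1" and c: "c > 0"
    and A: "A_Delta c F" and S: "S_Delta c (conv_power F N)" and D: "D_Delta c (conv_power F N)"
  shows "S_Delta c F"
proof -
  let ?f = "window c F" and ?G = "conv_power F N"
  let ?g = "window c ?G"
  have G: "real_distribution ?G" by (rule real_distribution_conv_power[OF F])
  have lt: "long_tailed ?g" using S by (simp add: S_Delta_def L_Delta_def)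
  note g_pos = long_tailed_pos[OF lt] and g_shift = long_tailed_shift[OF lt]
  obtain x0 where x0: "x0 > 0" "\<And>x. x \<ge> x0 \<Longrightarrow> 0 < ?f x" "bdd_above (?f ` {x0..})"
    and sup: "(\<lambda>x. SUP t\<in>{x..}. ?f t) \<sim>[at_top] ?f"
    and inf: "(\<lambda>x. INF t\<in>{x0..x}. ?f t) \<sim>[at_top] ?f"
    using A by (auto simp: A_Delta_def asymp_nonincreasing_def)
  define \<phi> \<psi> where "\<phi> x = (SUP t\<in>{x..}. ?f t)" and "\<psi> x = (INF t\<in>{x0..x}. ?f t)" for x
  have f_pos: "eventually (\<lambda>x. 0 < ?f x) at_top"
    using x0 by (auto simp: eventually_at_top_linorder)
  have bdd: "bdd_above (?f ` {x..})" if "x0 \<le> x" for x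
    by (rule bdd_above_mono[OF x0(3)]) (use that in auto)
  have bddb: "bdd_below (?f ` T)" for T
    by (rule bdd_belowI2[of _ 0]) (rule window_nonneg)
  have \<phi>_mono: "\<phi> t \<le> \<phi> s" if "x0 \<le> s" "s \<le> t" for s t
    unfolding \<phi>_def by (rule cSUP_subset_mono) (use bdd that in auto)
  have \<phi>_ge: "?f t \<le> \<phi> t" if "x0 \<le> t" for t
    unfolding \<phi>_def by (rule cSUP_upper) (use bdd that in auto)
  have \<psi>_mono: "\<psi> t \<le> \<psi> s" if "x0 \<le> s" "s \<le> t" for s t
    unfolding \<psi>_def by (rule cINF_superset_mono) (use bddb that in auto)
  have \<psi>_le: "\<psi> t \<le> ?f t" if "x0 \<le> t" for t
    unfolding \<psi>_def by (rule cINF_lower) (use bddb that in auto)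
  have \<psi>0: "0 \<le> \<psi> t" if "x0 \<le> t" for t
    unfolding \<psi>_def by (rule cINF_greatest) (use that in \<open>auto simp: window_nonneg\<close>)
  have \<phi>_f: "eventually (\<lambda>x. \<phi> x \<le> (1 + e) * ?f x) at_top" if "e > 0" for e
    using asymp_equiv_imp_le(1)[OF sup f_pos that] by (simp add: \<phi>_def)
  have \<psi>_f: "eventually (\<lambda>x. (1 - e) * ?f x \<le> \<psi> x) at_top" if "e > 0" for e
    using asymp_equiv_imp_le(2)[OF inf f_pos that] by (simp add: \<psi>_def)

  have upper: "eventually (\<lambda>x. real N * ?f x \<le> (1 + e) * ?g x) at_top" if e: "e > 0" for e
  proof -
    \<comment> \<open>Small enough for \<open>(1 + d) / (1 - d)\<^sup>2 \<le> 1 + e\<close>, which collects the three errors made below.\<close>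
    define d where "d = min (e / (3 + 3 * e)) (1/4)"
    have d: "0 < d" "d < 1" using e by (auto simp: d_def)
    have "d \<le> e / (3 + 3 * e)" by (simp add: d_def)
    then have small: "d * (3 + 3 * e) \<le> e" using e by (simp add: pos_le_divide_eq)
    have "(1 - d) * (1 - d) \<ge> 1 - 2 * d" by (simp add: algebra_simps)
    then have *: "(1 + e) * ((1 - d) * (1 - d)) \<ge> (1 + e) * (1 - 2 * d)"
      using e by (intro mult_left_mono) auto
    have dd: "1 + d \<le> (1 + e) * ((1 - d) * (1 - d))"
    proof -
      have "(1 + e) * (1 - 2 * d) = 1 + e - (d * (3 + 3 * e)) + d * (1 + e)"
        by (simp add: algebra_simps)
      moreover have "0 \<le> d * e" using d e by simp
      ultimately show ?thesis using * small by (simp add: algebra_simps)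
    qed
    obtain B where "B \<ge> 0" and B: "eventually (\<lambda>x. real N * (1 - d) * \<psi> (x + B) \<le> ?g x) at_top"
      using conv_power_window_ge[OF F \<psi>_mono \<psi>0 \<psi>_le d, where k=N] by auto
    have "eventually (\<lambda>x. ?g (x + (- B)) \<le> (1 + d) * ?g x) at_top"
      by (rule asymp_equiv_imp_le(1)[OF g_shift g_pos d(1)])
    with eventually_shift[OF B, of "- B"] \<psi>_f[OF d(1)] show ?thesis
    proof eventually_elim
      case (elim x)
      have "((1 - d) * (1 - d)) * (real N * ?f x) = real N * (1 - d) * ((1 - d) * ?f x)"
        by (simp add: mult_ac)
      also have "\<dots> \<le> real N * (1 - d) * \<psi> x"
        using elim d by (intro mult_left_mono) auto
      also have "\<dots> \<le> (1 + d) * ?g x" using elim by simp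
      also have "\<dots> \<le> (1 + e) * ((1 - d) * (1 - d)) * ?g x"
        by (rule mult_right_mono[OF dd window_nonneg])
      finally have "((1 - d) * (1 - d)) * (real N * ?f x) \<le> ((1 - d) * (1 - d)) * ((1 + e) * ?g x)"
        by (simp add: mult_ac)
      then show ?case using d by (simp add: mult_le_cancel_left)
    qed
  qed

  have \<phi>_g: "eventually (\<lambda>x. \<phi> x \<le> 4 * ?g x) at_top"
    using \<phi>_f[of 1, simplified] upper[of 1, simplified]
  proof eventually_elim
    case (elim x)
    have "?f x \<le> real N * ?f x" using N mult_right_mono[of 1 "real N" "?f x"] by (simp add: window_nonneg)
    then show ?case using elim by linarith
  qed
  have le: "\<exists>B\<ge>0. eventually (\<lambda>x. window c (conv_power F k) x
      \<le> real k * \<phi> (x - B) + e * ?g x) at_top" if "0 < e" for e k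
    by (rule conv_power_window_le[OF F G _ S D \<phi>_mono \<phi>_ge _ \<phi>_g that, where ?x0.0=x0])
      (use c in auto)

  have lower: "eventually (\<lambda>x. (1 - e) * ?g x \<le> real N * ?f x) at_top" if e: "e > 0" "e < 1" for e
  proof -
    define d where "d = e / 3"
    have d: "0 < d" "d < 1" using e by (auto simp: d_def)
    have dd: "(1 - e) * (1 + d) \<le> (1 - d) * (1 - d)"
    proof -
      have "(1 - e) * (1 + d) = 1 - 2 * d - 3 * (d * d)" by (simp add: d_def field_simps)
      also have "\<dots> \<le> (1 - d) * (1 - d)" by (simp add: algebra_simps)
      finally show ?thesis .
    qed
    obtain B where "B \<ge> 0" and B: "eventually (\<lambda>x. ?g x \<le> real N * \<phi> (x - B) + d * ?g x) at_top"
      using le[OF d(1), where k=N] by auto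
    have "eventually (\<lambda>x. (1 - d) * ?g x \<le> ?g (x + B)) at_top"
      by (rule asymp_equiv_imp_le(2)[OF g_shift g_pos d(1)])
    with eventually_shift[OF B, of B] \<phi>_f[OF d(1)] show ?thesis
    proof eventually_elim
      case (elim x)
      have "(1 + d) * ((1 - e) * ?g x) \<le> (1 - d) * (1 - d) * ?g x"
        using mult_right_mono[OF dd window_nonneg[of c ?G x]] by (simp add: mult_ac)
      also have "\<dots> \<le> (1 - d) * ?g (x + B)"
        using elim d by simp
      also have "\<dots> \<le> real N * \<phi> x" using elim by (simp add: algebra_simps)
      also have "\<dots> \<le> real N * ((1 + d) * ?f x)" using elim by (intro mult_left_mono) auto
      finally have "(1 + d) * ((1 - e) * ?g x) \<le> (1 + d) * (real N * ?f x)" by (simp add: mult_ac)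
      then show ?case using d by (simp add: mult_le_cancel_left)
    qed
  qed

  have Nf: "(\<lambda>x. real N * ?f x) \<sim>[at_top] ?g"
    by (rule asymp_equiv_from_le[OF g_pos]) (use upper lower in auto)
  have f_shift: "(\<lambda>x. ?f (x + y)) \<sim>[at_top] ?f" for y
  proof -
    have "(\<lambda>x. real N * ?f (x + y)) \<sim>[at_top] (\<lambda>x. ?g (x + y))"
      by (rule asymp_equiv_compose'[OF Nf filterlim_shift_at_top])
    then have "(\<lambda>x. real N * ?f (x + y)) \<sim>[at_top] (\<lambda>x. real N * ?f x)"
      by (rule asymp_equiv_trans[OF asymp_equiv_trans[OF _ g_shift] asymp_equiv_symI[OF Nf]])
    then have "(\<lambda>x. inverse (real N) * (real N * ?f (x + y))) \<sim>[at_top]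
        (\<lambda>x. inverse (real N) * (real N * ?f x))"
      by (rule asymp_equiv_mult[OF asymp_equiv_refl])
    moreover have "(\<lambda>x. inverse (real N) * (real N * h x)) = h" for h :: "real \<Rightarrow> real"
      using N by (simp add: fun_eq_iff)
    ultimately show ?thesis by (simp only:)
  qed
  have f_lt: "long_tailed ?f"
    using x0 f_shift window_measurable[OF F] by (auto simp: long_tailed_def window_nonneg)

  have "window c (conv_power F 2) \<sim>[at_top] (\<lambda>x. 2 * ?f x)"
  proof (rule asymp_equiv_from_le)
    show "eventually (\<lambda>x. 0 < 2 * ?f x) at_top" using f_pos by simp
  next
    fix e :: real assume e: "0 < e" "e < 1"
    \<comment> \<open>The factor \<open>N\<close> pays for \<open>g \<le> 2 N f\<close>, which turns the error term \<open>d g\<close> into a multiple of \<open>f\<close>.\<close>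
    define d where "d = e / (4 * (real N + 1))"
    have d: "0 < d" "d < 1" "d * (real N + 1) * 4 = e" using e N
      by (auto simp: d_def field_simps add_strict_increasing)
    obtain B where "B \<ge> 0"
      and B: "eventually (\<lambda>x. window c (conv_power F 2) x \<le> 2 * \<phi> (x - B) + d * ?g x) at_top"
      using le[OF d(1), where k=2] by auto
    have "eventually (\<lambda>x. ?f (x + (- B)) \<le> (1 + d) * ?f x) at_top"
      by (rule asymp_equiv_imp_le(1)[OF f_shift f_pos d(1)])
    moreover have "eventually (\<lambda>x. \<phi> (x + (- B)) \<le> (1 + d) * ?f (x + (- B))) at_top"
      by (rule eventually_shift[OF \<phi>_f[OF d(1)]])
    moreover have "eventually (\<lambda>x. (1 - 1/2) * ?g x \<le> real N * ?f x) at_top" by (rule lower) auto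
    ultimately show "eventually (\<lambda>x. window c (conv_power F 2) x \<le> (1 + e) * (2 * ?f x)) at_top"
      using B
    proof eventually_elim
      case (elim x)
      have "(1 + d) * ?f (x + (- B)) \<le> (1 + d) * ((1 + d) * ?f x)"
        using elim d by (intro mult_left_mono) auto
      then have "\<phi> (x - B) \<le> (1 + d) * (1 + d) * ?f x" using elim by simp
      moreover have "d * ?g x \<le> d * (2 * (real N * ?f x))"
        using elim d by (intro mult_left_mono) auto
      ultimately have "window c (conv_power F 2) x \<le>
          ((1 + d) * (1 + d) + d * real N) * (2 * ?f x)"
        using elim by (simp add: algebra_simps)
      also have "\<dots> \<le> (1 + e) * (2 * ?f x)"
      proof (rule mult_right_mono)
        have "d * d \<le> d" using d mult_left_mono[of d 1 d] by simp
        moreover have "0 \<le> d * real N" using d by simp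
        moreover have "e = 4 * (d * real N) + 4 * d" using d(3) by (simp add: algebra_simps)
        moreover have "(1 + d) * (1 + d) + d * real N = 1 + 2 * d + d * d + d * real N"
          by (simp add: algebra_simps)
        ultimately show "(1 + d) * (1 + d) + d * real N \<le> 1 + e"
          using d(1) by linarith
      qed (simp add: window_nonneg)
      finally show ?case .
    qed
  next
    fix e :: real assume e: "0 < e" "e < 1"
    define d where "d = e / 3"
    have d: "0 < d" "d < 1" using e by (auto simp: d_def)
    have dd: "1 - e \<le> (1 - d) * ((1 - d) * (1 - d))"
    proof -
      have "(1 - d) * ((1 - d) * (1 - d)) - (1 - e) = d * d * (3 - d)"
        by (simp add: d_def field_simps)
      moreover have "0 \<le> d * d * (3 - d)" using d by simp
      ultimately show ?thesis by linarith
    qed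
    obtain B where "B \<ge> 0"
      and B: "eventually (\<lambda>x. 2 * (1 - d) * \<psi> (x + B) \<le> window c (conv_power F 2) x) at_top"
      using conv_power_window_ge[OF F \<psi>_mono \<psi>0 \<psi>_le d, where k=2] by auto
    have "eventually (\<lambda>x. (1 - d) * ?f x \<le> ?f (x + B)) at_top"
      by (rule asymp_equiv_imp_le(2)[OF f_shift f_pos d(1)])
    with B eventually_shift[OF \<psi>_f[OF d(1)], of B]
    show "eventually (\<lambda>x. (1 - e) * (2 * ?f x) \<le> window c (conv_power F 2) x) at_top"
    proof eventually_elim
      case (elim x)
      have "(1 - e) * (2 * ?f x) \<le> (1 - d) * ((1 - d) * (1 - d)) * (2 * ?f x)"
        by (rule mult_right_mono[OF dd]) (simp add: window_nonneg)
      also have "\<dots> = 2 * (1 - d) * ((1 - d) * ((1 - d) * ?f x))" by (simp add: mult_ac)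
      also have "\<dots> \<le> 2 * (1 - d) * ((1 - d) * ?f (x + B))"
        using elim d by (intro mult_left_mono) auto
      also have "\<dots> \<le> 2 * (1 - d) * \<psi> (x + B)"
        using elim d by (intro mult_left_mono) auto
      finally show ?case using elim by linarith
    qed
  qed
  then show ?thesis using f_lt by (simp add: S_Delta_def L_Delta_def)
qed

theorem proposition3p4:
  fixes F :: "real measure" and N :: nat
  assumes "real_distribution F" and "N \<ge> 1"
  shows "(\<forall>c>0. A_Delta c F \<and> S_Delta c (conv_power F N) \<and> D_Delta c (conv_power F N)
            \<longrightarrow> S_Delta c F) \<and>
         (A_loc F \<and> S_loc (conv_power F N) \<and> D_loc (conv_power F N) \<longrightarrow> S_loc F)"
  using S_Delta_convolution_root[OF assms]
  by (auto simp: A_loc_def S_loc_def D_loc_def)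

end
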